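(* Let $(X,\mathcal{A})$ be a measurable space, let $Y=[0,m]$ or $Y=[0,m)$ with $0<m\le\infty$, let $\mu$ be a monotone measure on $\mathcal{A}$ and let $D\in\mathcal{A}$. Let $\star,\lozenge\colon Y^2\to Y$ and $\circ_i\colon Y\times\mu(\mathcal{A})\to Y$ ($i=1,2,3$) be operators such that $\lozenge$ and all $\circ_i$ are nondecreasing and $0\circ_i x=y\circ_i 0=0$ for all $y\in Y$, $x\in\mu(\mathcal{A})$, $i=1,2,3$. Let $\phi_i\colon Y\to Y$ be increasing with $\phi_i(Y)=Y$ for $i=1,2,3$. Then the inequality $$\phi_1^{-1}\Big(\int_{\circ_1,D}\phi_1(f\star g)\,d\mu\Big)\le \phi_2^{-1}\Big(\int_{\circ_2,D}\phi_2(f)\,d\mu\Big)\ \lozenge\ \phi_3^{-1}\Big(\int_{\circ_3,D}\phi_3(g)\,d\mu\Big)$$ is satisfied for all functions $f,g\colon X\to Y$ that are $\star$-associated on $D$ if and only if for all $a,b\in Y$ and all $c\in\mu(\mathcal{A}\cap D)$ $$\phi_1^{-1}\big(\phi_1(a\star b)\circ_1 c\big)\le \phi_2^{-1}\big(\phi_2(a)\circ_2 c\big)\ \lozenge\ \phi_3^{-1}\big(\phi_3(b)\circ_3 c\big).$$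
   Context: A monotone measure on $\mathcal{A}$ is a set function $\mu\colon\mathcal{A}\to[0,\infty]$ with $\mu(\emptyset)=0$ and $\mu(A)\le\mu(B)$ for $A\subset B$. Notation: $\mu(\mathcal{A})=\{\mu(A):A\in\mathcal{A}\}$ and $\mu(\mathcal{A}\cap D)=\{\mu(A\cap D):A\in\mathcal{A}\}$. A binary operator $\circ$ is nondecreasing if $a\circ b\le x\circ y$ whenever $a\le x$ and $b\le y$. "Increasing" for $\phi_i$ means strictly increasing, and $\phi_i^{-1}$ is the inverse function. Functions $f,g\colon X\to Y$ are $\star$-associated on $D$ if for every nonempty measurable $A\subset D$: $\inf_{x\in A}\{f(x)\star g(x)\}=\big(\inf_{x\in A}f(x)\big)\star\big(\inf_{x\in A}g(x)\big)$; here $(f\star g)(x)=f(x)\star g(x)$. The generalized upper Sugeno integral of a measurable $f\colon X\to Y$ is $\int_{\circ,D}f\,d\mu:=\sup_{t\in Y}\{t\circ\mu(D\cap\{f\ge t\})\}$, where $\{f\ge t\}=\{x\in X:f(x)\ge t\}$. Convention: $f,g$ and $f\star g$ are measurable and (relevant only if $Y=[0,m)$) the integrals that appear lie in $Y$, so that all expressions are defined. *)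

theory Defs
  imports "HOL-Analysis.Analysis"
begin

text \<open>
  A measurable space is given by \<open>M :: 'a measure\<close>, of which only \<open>space M\<close> and \<open>sets M\<close> are used;
  the monotone measure is a separate set function \<open>\<mu>\<close>, unrelated to \<open>emeasure M\<close>.
  Operators on subsets of \<open>[0,\<infinity>]\<close> are total functions on \<^typ>\<open>ennreal\<close> about which nothing is
  assumed outside the intended domain.
\<close>

definition monotone_measure :: "'a measure \<Rightarrow> ('a set \<Rightarrow> ennreal) \<Rightarrow> bool" where
  "monotone_measure M \<mu> \<longleftrightarrow>
     \<mu> {} = 0 \<and> (\<forall>A\<in>sets M. \<forall>B\<in>sets M. A \<subseteq> B \<longrightarrow> \<mu> A \<le> \<mu> B)"

definition nondecreasing_op ::
    "ennreal set \<Rightarrow> ennreal set \<Rightarrow> (ennreal \<Rightarrow> ennreal \<Rightarrow> ennreal) \<Rightarrow> bool" where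
  "nondecreasing_op S T op \<longleftrightarrow>
     (\<forall>a\<in>S. \<forall>x\<in>S. \<forall>b\<in>T. \<forall>y\<in>T. a \<le> x \<longrightarrow> b \<le> y \<longrightarrow> op a b \<le> op x y)"

definition star_associated ::
    "(ennreal \<Rightarrow> ennreal \<Rightarrow> ennreal) \<Rightarrow> 'a measure \<Rightarrow> 'a set \<Rightarrow>
     ('a \<Rightarrow> ennreal) \<Rightarrow> ('a \<Rightarrow> ennreal) \<Rightarrow> bool" where
  "star_associated star M D f g \<longleftrightarrow>
     (\<forall>A\<in>sets M. A \<noteq> {} \<longrightarrow> A \<subseteq> D \<longrightarrow>
        (INF x\<in>A. star (f x) (g x)) = star (INF x\<in>A. f x) (INF x\<in>A. g x))"

text \<open>
  The supremum is taken in \<open>[0,\<infinity>]\<close>, so for \<open>Y = [0,m)\<close> it may fall outside \<open>Y\<close>.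
\<close>

definition upper_sugeno ::
    "ennreal set \<Rightarrow> (ennreal \<Rightarrow> ennreal \<Rightarrow> ennreal) \<Rightarrow> 'a measure \<Rightarrow> ('a set \<Rightarrow> ennreal) \<Rightarrow>
     'a set \<Rightarrow> ('a \<Rightarrow> ennreal) \<Rightarrow> ennreal" where
  "upper_sugeno Y circ M \<mu> D f = (SUP t\<in>Y. circ t (\<mu> (D \<inter> {x \<in> space M. f x \<ge> t})))"

end

theory Submission imports Defs begin

text \<open>
  Sufficiency: if \<open>A = D \<inter> {\<phi>\<^sub>1(f \<star> g) \<ge> t}\<close> is nonempty, apply the pointwise inequality to
  \<open>a = inf\<^sub>A f\<close>, \<open>b = inf\<^sub>A g\<close> and \<open>c = \<mu>(A)\<close>. Association gives \<open>\<phi>\<^sub>1(a \<star> b) \<ge> t\<close>, and \<open>A\<close> is contained in the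
  level sets \<open>{f \<ge> a}\<close> and \<open>{g \<ge> b}\<close>, so the right-hand side is dominated by the two integrals.

  Necessity: if \<open>0 \<star> 0 \<le> a \<star> b\<close>, then the functions \<open>f, g\<close> equal to \<open>a, b\<close> on \<open>A \<inter> D\<close> and to \<open>0\<close>
  elsewhere are associated, and the integral inequality for them is stronger than the pointwise one.
  Nothing forces \<open>\<star>\<close> to be nondecreasing, so \<open>a \<star> b < 0 \<star> 0\<close> may occur; then the constant
  functions \<open>0\<close> bound \<open>\<phi>\<^sub>1\<^sup>-\<^sup>1(\<phi>\<^sub>1(0 \<star> 0) \<circ>\<^sub>1 \<mu>(D))\<close> by \<open>0 \<lozenge> 0\<close>, which already suffices.
\<close>

section \<open>Order-preserving inverses, level sets and two-valued functions\<close>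

lemma nondecreasing_opD:
  assumes "nondecreasing_op S T op" "a \<in> S" "x \<in> S" "b \<in> T" "y \<in> T" "a \<le> x" "b \<le> y"
  shows "op a b \<le> op x y"
  using assms unfolding nondecreasing_op_def by blast

text \<open>A strictly increasing map on a linear order reflects \<le>, so an inverse can be traded
  for \<phi> on the other side.\<close>

lemma inv_into_le_iff:
  fixes \<phi> :: "'b::linorder \<Rightarrow> 'c::linorder"
  assumes "strict_mono_on Y \<phi>" "y \<in> \<phi> ` Y" "x \<in> Y"
  shows "inv_into Y \<phi> y \<le> x \<longleftrightarrow> y \<le> \<phi> x"
  using strict_mono_on_less_eq[OF assms(1) inv_into_into[OF assms(2)] assms(3)]
  by (simp add: f_inv_into_f[OF assms(2)])

lemma inv_into_mono:
  fixes \<phi> :: "'b::linorder \<Rightarrow> 'c::linorder"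
  assumes "strict_mono_on Y \<phi>" "x \<in> \<phi> ` Y" "y \<in> \<phi> ` Y" "x \<le> y"
  shows "inv_into Y \<phi> x \<le> inv_into Y \<phi> y"
  using assms by (simp add: inv_into_le_iff inv_into_into f_inv_into_f)

text \<open>A preimage \<open>z\<close> of 0 satisfies 0 \<le> \<open>z\<close>, which forces
  \<open>\<phi> 0 \<le> \<phi> z = 0\<close>.\<close>

lemma strict_mono_on_onto_zero:
  fixes \<phi> :: "ennreal \<Rightarrow> ennreal"
  assumes "strict_mono_on Y \<phi>" "\<phi> ` Y = Y" "0 \<in> Y"
  shows "\<phi> 0 = 0"
proof -
  obtain z where "z \<in> Y" "\<phi> z = 0"
    using assms by (metis imageE)
  then show ?thesis
    using strict_mono_on_leD[OF assms(1) assms(3), of z] by simp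
qed

text \<open>The term of the supremum at \<open>t\<close> dominates by monotonicity of \<mu>, which
  is available only between measurable sets; hence the condition on the level set.\<close>

lemma upper_sugeno_ge:
  assumes "nondecreasing_op Y (\<mu> ` sets M) circ" "monotone_measure M \<mu>"
    and "t \<in> Y" "A \<in> sets M" "D \<inter> {x \<in> space M. t \<le> h x} \<in> sets M"
    and "A \<subseteq> D \<inter> {x \<in> space M. t \<le> h x}"
  shows "circ t (\<mu> A) \<le> upper_sugeno Y circ M \<mu> D h"
proof -
  let ?L = "D \<inter> {x \<in> space M. t \<le> h x}"
  have "\<mu> A \<le> \<mu> ?L"
    using assms unfolding monotone_measure_def by blast
  then have "circ t (\<mu> A) \<le> circ t (\<mu> ?L)"
    using assms by (intro nondecreasing_opD[OF assms(1)]) auto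
  also have "\<dots> \<le> upper_sugeno Y circ M \<mu> D h"
    unfolding upper_sugeno_def using assms(3) by (rule SUP_upper)
  finally show ?thesis .
qed

text \<open>The level set at \<open>t\<close> is \<open>D\<close>, \<open>B\<close> or empty
  according as \<open>t \<le> q\<close>, \<open>q < t \<le> p\<close> or \<open>p < t\<close>. In
  the first two cases the term grows when \<open>t\<close> is raised to \<open>q\<close> or
  \<open>p\<close>; in the third it is 0.\<close>

lemma upper_sugeno_two_valued_le:
  assumes "nondecreasing_op Y (\<mu> ` sets M) circ" "\<mu> {} = 0"
    and "\<And>y. y \<in> Y \<Longrightarrow> circ y 0 = 0"
    and "D \<in> sets M" "B \<in> sets M" "B \<subseteq> D" "p \<in> Y" "q \<in> Y" "q \<le> p"
  shows "upper_sugeno Y circ M \<mu> D (\<lambda>x. if x \<in> B then p else q)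
    \<le> max (circ q (\<mu> D)) (circ p (\<mu> B))"
  unfolding upper_sugeno_def
proof (rule SUP_least)
  fix t assume t: "t \<in> Y"
  let ?L = "D \<inter> {x \<in> space M. t \<le> (if x \<in> B then p else q)}"
  have sp: "D \<subseteq> space M"
    using assms(4) by (rule sets.sets_into_space)
  consider "t \<le> q" | "q < t" "t \<le> p" | "p < t"
    by (meson not_le)
  then show "circ t (\<mu> ?L) \<le> max (circ q (\<mu> D)) (circ p (\<mu> B))"
  proof cases
    case 1
    then have "?L = D"
      using sp assms(9) by auto
    moreover have "circ t (\<mu> D) \<le> circ q (\<mu> D)"
      using 1 t assms by (intro nondecreasing_opD[OF assms(1)]) auto
    ultimately show ?thesis by (simp add: max.coboundedI1)
  next
    case 2
    then have "?L = B"
      using sp assms(6) by auto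
    moreover have "circ t (\<mu> B) \<le> circ p (\<mu> B)"
      using 2 t assms by (intro nondecreasing_opD[OF assms(1)]) auto
    ultimately show ?thesis by (simp add: max.coboundedI2)
  next
    case 3
    then have "?L = {}"
      using assms(9) by auto
    then show ?thesis
      using assms(2) assms(3)[OF t] by (simp only: zero_le)
  qed
qed

text \<open>All three functions are two-valued, with the smaller value off \<open>B\<close>; for
  \<open>star\<close> this is the hypothesis. So each infimum over \<open>A\<close> is the value on
  \<open>B\<close> if \<open>A \<subseteq> B\<close> and the value off \<open>B\<close>
  otherwise.\<close>

lemma star_associated_two_valued:
  assumes "star 0 0 \<le> star a b"
  shows "star_associated star M D (\<lambda>x. if x \<in> B then a else 0) (\<lambda>x. if x \<in> B then b else 0)"
  unfolding star_associated_def
proof (intro ballI impI)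
  fix A assume A: "A \<in> sets M" "A \<noteq> {}" "A \<subseteq> D"
  have inf_if: "(INF x\<in>A. if x \<in> B then p else q) = (if A \<subseteq> B then p else q)"
    if "q \<le> p" for p q :: ennreal
  proof (cases "A \<subseteq> B")
    case True
    then have "(INF x\<in>A. if x \<in> B then p else q) = (INF x\<in>A. p)"
      by (intro INF_cong) auto
    with True A(2) show ?thesis by simp
  next
    case False
    then obtain x where x: "x \<in> A" "x \<notin> B" by blast
    have "(INF x\<in>A. if x \<in> B then p else q) = q"
    proof (rule antisym)
      show "(INF x\<in>A. if x \<in> B then p else q) \<le> q"
        using x by (intro INF_lower2[of x]) auto
      show "q \<le> (INF x\<in>A. if x \<in> B then p else q)"
        using that by (intro INF_greatest) auto
    qed
    with False show ?thesis by simp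
  qed
  have "(INF x\<in>A. star (if x \<in> B then a else 0) (if x \<in> B then b else 0))
      = (INF x\<in>A. if x \<in> B then star a b else star 0 0)"
    by (intro INF_cong) auto
  then show "(INF x\<in>A. star (if x \<in> B then a else 0) (if x \<in> B then b else 0))
      = star (INF x\<in>A. if x \<in> B then a else 0) (INF x\<in>A. if x \<in> B then b else 0)"
    by (simp only: inf_if[OF assms] inf_if[OF zero_le] split: if_split) simp
qed

theorem theorem1:
  fixes M :: "'a measure" and D :: "'a set" and \<mu> :: "'a set \<Rightarrow> ennreal"
    and m :: ennreal and Y :: "ennreal set"
    and star loz :: "ennreal \<Rightarrow> ennreal \<Rightarrow> ennreal"
    and circ :: "nat \<Rightarrow> ennreal \<Rightarrow> ennreal \<Rightarrow> ennreal"
    and \<phi> :: "nat \<Rightarrow> ennreal \<Rightarrow> ennreal"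
  assumes "0 < m" and "Y = {0..m} \<or> Y = {0..<m}"
    and "monotone_measure M \<mu>" and "D \<in> sets M"
    and "star \<in> Y \<rightarrow> Y \<rightarrow> Y"
    and "loz \<in> Y \<rightarrow> Y \<rightarrow> Y" and "nondecreasing_op Y Y loz"
    and "\<And>i. i \<in> {1, 2, 3} \<Longrightarrow> circ i \<in> Y \<rightarrow> \<mu> ` sets M \<rightarrow> Y"
    and "\<And>i. i \<in> {1, 2, 3} \<Longrightarrow> nondecreasing_op Y (\<mu> ` sets M) (circ i)"
    and "\<And>i x. i \<in> {1, 2, 3} \<Longrightarrow> x \<in> \<mu> ` sets M \<Longrightarrow> circ i 0 x = 0"
    and "\<And>i y. i \<in> {1, 2, 3} \<Longrightarrow> y \<in> Y \<Longrightarrow> circ i y 0 = 0"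
    and "\<And>i. i \<in> {1, 2, 3} \<Longrightarrow> strict_mono_on Y (\<phi> i)"
    and "\<And>i. i \<in> {1, 2, 3} \<Longrightarrow> \<phi> i ` Y = Y"
  shows
    "(\<forall>f g. f \<in> space M \<rightarrow> Y \<longrightarrow> g \<in> space M \<rightarrow> Y \<longrightarrow>
        f \<in> borel_measurable M \<longrightarrow> g \<in> borel_measurable M \<longrightarrow>
        (\<lambda>x. star (f x) (g x)) \<in> borel_measurable M \<longrightarrow>
        upper_sugeno Y (circ 1) M \<mu> D (\<lambda>x. \<phi> 1 (star (f x) (g x))) \<in> Y \<longrightarrow>
        upper_sugeno Y (circ 2) M \<mu> D (\<lambda>x. \<phi> 2 (f x)) \<in> Y \<longrightarrow>
        upper_sugeno Y (circ 3) M \<mu> D (\<lambda>x. \<phi> 3 (g x)) \<in> Y \<longrightarrow>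
        star_associated star M D f g \<longrightarrow>
        inv_into Y (\<phi> 1) (upper_sugeno Y (circ 1) M \<mu> D (\<lambda>x. \<phi> 1 (star (f x) (g x))))
        \<le> loz (inv_into Y (\<phi> 2) (upper_sugeno Y (circ 2) M \<mu> D (\<lambda>x. \<phi> 2 (f x))))
              (inv_into Y (\<phi> 3) (upper_sugeno Y (circ 3) M \<mu> D (\<lambda>x. \<phi> 3 (g x)))))
     \<longleftrightarrow>
     (\<forall>a\<in>Y. \<forall>b\<in>Y. \<forall>c\<in>{\<mu> (A \<inter> D) | A. A \<in> sets M}.
        inv_into Y (\<phi> 1) (circ 1 (\<phi> 1 (star a b)) c)
        \<le> loz (inv_into Y (\<phi> 2) (circ 2 (\<phi> 2 a) c))
              (inv_into Y (\<phi> 3) (circ 3 (\<phi> 3 b) c)))"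
    (is "?integral \<longleftrightarrow> ?pointwise")
proof -

  \<comment> \<open>Closure properties of \<open>Y\<close> and order properties of \<phi> and its
    inverse\<close>
  note mono_loz = nondecreasing_opD[OF assms(7)]
  note mono_circ = nondecreasing_opD[OF assms(9)]
  let ?I = "\<lambda>i h. upper_sugeno Y (circ i) M \<mu> D (\<lambda>x. \<phi> i (h x))"
  have zero: "0 \<in> Y"
    using assms(1,2) by auto
  have down: "x \<in> Y" if "x \<le> y" "y \<in> Y" for x y
    using assms(2) that by (auto intro: order_trans le_less_trans)
  have star: "star a b \<in> Y" and loz: "loz a b \<in> Y" if "a \<in> Y" "b \<in> Y" for a b
    using assms(5,6) that by blast+
  have circ: "circ i a (\<mu> A) \<in> Y" if "i \<in> {1,2,3}" "a \<in> Y" "A \<in> sets M" for i a A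
    using assms(8)[OF that(1)] that by blast
  have phi: "\<phi> i a \<in> Y" if "i \<in> {1,2,3}" "a \<in> Y" for i a
    using assms(13)[OF that(1)] that by blast
  have phi0: "\<phi> i 0 = 0" if "i \<in> {1,2,3}" for i
    using strict_mono_on_onto_zero[OF assms(12,13)] that zero by blast
  have phi_le: "\<phi> i a \<le> \<phi> i b \<longleftrightarrow> a \<le> b" if "i \<in> {1,2,3}" "a \<in> Y" "b \<in> Y" for i a b
    using strict_mono_on_less_eq[OF assms(12)[OF that(1)]] that by blast
  have inv: "inv_into Y (\<phi> i) a \<in> Y" if "i \<in> {1,2,3}" "a \<in> Y" for i a
    using inv_into_into[of a "\<phi> i" Y] assms(13)[OF that(1)] that by simp
  have inv_le: "inv_into Y (\<phi> i) y \<le> x \<longleftrightarrow> y \<le> \<phi> i x"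
    if "i \<in> {1,2,3}" "y \<in> Y" "x \<in> Y" for i x y
    using inv_into_le_iff[OF assms(12)[OF that(1)]] assms(13)[OF that(1)] that by blast
  have inv_mono: "inv_into Y (\<phi> i) x \<le> inv_into Y (\<phi> i) y"
    if "i \<in> {1,2,3}" "x \<in> Y" "y \<in> Y" "x \<le> y" for i x y
    using inv_into_mono[OF assms(12)[OF that(1)]] assms(13)[OF that(1)] that(2-4) by simp
  have empty: "\<mu> {} = 0"
    using assms(3) unfolding monotone_measure_def by blast
  show ?thesis
  proof

    \<comment> \<open>Necessity of the pointwise inequality\<close>
    assume int: ?integral
    have key: "inv_into Y (\<phi> 1) (circ 1 (\<phi> 1 (star a b)) (\<mu> B))
        \<le> loz (inv_into Y (\<phi> 2) (circ 2 (\<phi> 2 a) (\<mu> B)))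
              (inv_into Y (\<phi> 3) (circ 3 (\<phi> 3 b) (\<mu> B)))"
      if ab: "a \<in> Y" "b \<in> Y" and B: "B \<in> sets M" "B \<subseteq> D" and le: "star 0 0 \<le> star a b"
      for a b B
    proof -
      define f g where "f = (\<lambda>x. if x \<in> B then a else 0)" and "g = (\<lambda>x. if x \<in> B then b else 0)"
      have fg: "star (f x) (g x) = (if x \<in> B then star a b else star 0 0)" for x
        by (auto simp: f_def g_def)
      have comp: "(\<lambda>x. \<phi> i (if x \<in> B then p else q)) = (\<lambda>x. if x \<in> B then \<phi> i p else \<phi> i q)"
        for i p q
        by auto
      have two: "?I i (\<lambda>x. if x \<in> B then p else q)
          \<le> max (circ i (\<phi> i q) (\<mu> D)) (circ i (\<phi> i p) (\<mu> B))"
        if "i \<in> {1,2,3}" "p \<in> Y" "q \<in> Y" "q \<le> p" for i p q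
        unfolding comp using that phi phi_le
        by (intro upper_sugeno_two_valued_le assms(9,11,4) empty B) auto
      \<comment> \<open>With lower value 0 the term for \<open>D\<close> vanishes, since
        \<open>\<phi> i 0 = 0\<close> and 0 annihilates.\<close>
      have two0: "?I i (\<lambda>x. if x \<in> B then p else 0) \<le> circ i (\<phi> i p) (\<mu> B)"
        if "i \<in> {1,2,3}" "p \<in> Y" for i p
        using two[OF that zero] phi0[OF that(1)] assms(10)[OF that(1)] assms(4) by simp
      have f_le: "?I 2 f \<le> circ 2 (\<phi> 2 a) (\<mu> B)" and g_le: "?I 3 g \<le> circ 3 (\<phi> 3 b) (\<mu> B)"
        unfolding f_def g_def using two0 ab by auto
      \<comment> \<open>The assumed inequality speaks only of integrals in \<open>Y\<close>. For
        \<open>Y = {0..<m}\<close> a supremum may leave \<open>Y\<close>, so membership is deduced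
        from an upper bound in \<open>Y\<close>.\<close>
      have f_Y: "?I 2 f \<in> Y" and g_Y: "?I 3 g \<in> Y"
        using down[OF f_le] down[OF g_le] circ phi ab B by auto
      \<comment> \<open>Here the lower value \<open>star 0 0\<close> may be positive, so the term
        for \<open>D\<close> stays; the bound serves only to place the integral in
        \<open>Y\<close>.\<close>
      have "?I 1 (\<lambda>x. star (f x) (g x))
          \<le> max (circ 1 (\<phi> 1 (star 0 0)) (\<mu> D)) (circ 1 (\<phi> 1 (star a b)) (\<mu> B))"
        unfolding fg by (rule two) (use star ab zero le in auto)
      moreover have "\<dots> \<in> Y"
        using circ phi star ab zero B assms(4) unfolding max_def by auto
      ultimately have fg_Y: "?I 1 (\<lambda>x. star (f x) (g x)) \<in> Y"
        by (rule down)
      have "{x \<in> space M. \<phi> 1 (star a b) \<le> (if x \<in> B then \<phi> 1 (star a b) else \<phi> 1 (star 0 0))}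
          \<in> sets M"
        using B(1) by measurable
      then have "circ 1 (\<phi> 1 (star a b)) (\<mu> B) \<le> ?I 1 (\<lambda>x. star (f x) (g x))"
        unfolding fg comp using phi star ab B sets.sets_into_space[OF B(1)]
        by (intro upper_sugeno_ge assms(9,3) sets.Int assms(4)) auto
      then have "inv_into Y (\<phi> 1) (circ 1 (\<phi> 1 (star a b)) (\<mu> B))
          \<le> inv_into Y (\<phi> 1) (?I 1 (\<lambda>x. star (f x) (g x)))"
        using circ phi star ab B fg_Y by (intro inv_mono) auto
      also have "\<dots> \<le> loz (inv_into Y (\<phi> 2) (?I 2 f)) (inv_into Y (\<phi> 3) (?I 3 g))"
      proof -
        have "f \<in> space M \<rightarrow> Y" "g \<in> space M \<rightarrow> Y"
          using ab zero by (auto simp: f_def g_def)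
        moreover have "f \<in> borel_measurable M" "g \<in> borel_measurable M"
          "(\<lambda>x. star (f x) (g x)) \<in> borel_measurable M"
          unfolding fg unfolding f_def g_def using B by measurable
        moreover have "star_associated star M D f g"
          unfolding f_def g_def using le by (rule star_associated_two_valued)
        ultimately show ?thesis
          using int fg_Y f_Y g_Y by blast
      qed
      also have "\<dots> \<le> loz (inv_into Y (\<phi> 2) (circ 2 (\<phi> 2 a) (\<mu> B)))
              (inv_into Y (\<phi> 3) (circ 3 (\<phi> 3 b) (\<mu> B)))"
        using f_le g_le f_Y g_Y circ phi ab B by (intro mono_loz inv inv_mono) auto
      finally show ?thesis .
    qed
    show ?pointwise
    proof (intro ballI)
      fix a b c assume ab: "a \<in> Y" "b \<in> Y" and "c \<in> {\<mu> (A \<inter> D) | A. A \<in> sets M}"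
      then obtain A where A: "A \<in> sets M" "c = \<mu> (A \<inter> D)"
        by blast
      have B: "A \<inter> D \<in> sets M" "A \<inter> D \<subseteq> D"
        using A assms(4) by auto
      show "inv_into Y (\<phi> 1) (circ 1 (\<phi> 1 (star a b)) c)
        \<le> loz (inv_into Y (\<phi> 2) (circ 2 (\<phi> 2 a) c))
              (inv_into Y (\<phi> 3) (circ 3 (\<phi> 3 b) c))"
      proof (cases "star 0 0 \<le> star a b")
        case True
        then show ?thesis
          using key[OF ab B] A by simp
      next
        case False
        have "\<mu> (A \<inter> D) \<le> \<mu> D"
          using assms(3,4) B unfolding monotone_measure_def by blast
        then have "circ 1 (\<phi> 1 (star a b)) c \<le> circ 1 (\<phi> 1 (star 0 0)) (\<mu> D)"
          using False ab zero star phi phi_le B A(2) assms(4) by (intro mono_circ) auto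
        then have "inv_into Y (\<phi> 1) (circ 1 (\<phi> 1 (star a b)) c)
            \<le> inv_into Y (\<phi> 1) (circ 1 (\<phi> 1 (star 0 0)) (\<mu> D))"
          using ab zero star phi circ B A(2) assms(4) by (intro inv_mono) auto
        \<comment> \<open>This is \<open>key\<close> with both values 0 and \<open>B = D\<close>,
          where its order condition is trivial.\<close>
        also have "\<dots> \<le> loz (inv_into Y (\<phi> 2) (circ 2 (\<phi> 2 0) (\<mu> D)))
              (inv_into Y (\<phi> 3) (circ 3 (\<phi> 3 0) (\<mu> D)))"
          using key[OF zero zero assms(4)] by simp
        \<comment> \<open>Both arguments on the left are inverse images of 0, because
          \<open>\<phi> i 0 = 0\<close> and 0 annihilates; they lie below those on the
          right.\<close>
        also have "\<dots> \<le> loz (inv_into Y (\<phi> 2) (circ 2 (\<phi> 2 a) c))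
              (inv_into Y (\<phi> 3) (circ 3 (\<phi> 3 b) c))"
          using ab zero phi phi0 assms(4,10) circ B A(2)
          by (intro mono_loz inv inv_mono) auto
        finally show ?thesis .
      qed
    qed
  next

    \<comment> \<open>Sufficiency of the pointwise inequality\<close>
    assume pt: ?pointwise
    show ?integral
    proof (intro allI impI)
      fix f g
      assume f: "f \<in> space M \<rightarrow> Y" and g: "g \<in> space M \<rightarrow> Y"
        and meas: "f \<in> borel_measurable M" "g \<in> borel_measurable M"
          "(\<lambda>x. star (f x) (g x)) \<in> borel_measurable M"
        and I_Y: "?I 1 (\<lambda>x. star (f x) (g x)) \<in> Y" "?I 2 f \<in> Y" "?I 3 g \<in> Y"
        and assoc: "star_associated star M D f g"
      let ?R = "loz (inv_into Y (\<phi> 2) (?I 2 f)) (inv_into Y (\<phi> 3) (?I 3 g))"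
      have R: "?R \<in> Y"
        using I_Y by (intro loz inv) auto
      have D: "D \<subseteq> space M"
        using assms(4) by (rule sets.sets_into_space)
      \<comment> \<open>Level sets of \<open>\<phi> i\<close> after \<open>h\<close> become level
        sets of \<open>h\<close>, so their measurability follows from that of \<open>h\<close>
        alone.\<close>
      have level: "{x \<in> space M. \<phi> i s \<le> \<phi> i (h x)} = {x \<in> space M. s \<le> h x}"
        if "i \<in> {1,2,3}" "s \<in> Y" "h \<in> space M \<rightarrow> Y" for i s h
        using phi_le that by blast
      \<comment> \<open>\<open>A\<close> lies in the level set of \<open>h\<close> at its own
        infimum over \<open>A\<close>.\<close>
      have inf_ge: "circ i (\<phi> i (INF x\<in>A. h x)) (\<mu> A) \<le> ?I i h"
        if "i \<in> {1,2,3}" "(INF x\<in>A. h x) \<in> Y" "h \<in> space M \<rightarrow> Y" "h \<in> borel_measurable M"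
          "A \<in> sets M" "A \<subseteq> D" for i h A
        using that phi D unfolding level[OF that(1-3), symmetric]
        by (intro upper_sugeno_ge assms(9,3) sets.Int assms(4))
          (auto simp: level phi_le intro: INF_lower)
      \<comment> \<open>Moving the inverse of \<open>\<phi> 1\<close> to the right turns the claim
        into a bound for each term of the supremum.\<close>
      have "circ 1 t (\<mu> (D \<inter> {x \<in> space M. t \<le> \<phi> 1 (star (f x) (g x))})) \<le> \<phi> 1 ?R"
        if "t \<in> Y" for t
      proof -
        obtain s where s: "s \<in> Y" "t = \<phi> 1 s"
          using \<open>t \<in> Y\<close> assms(13)[of 1] by blast
        define A where "A = D \<inter> {x \<in> space M. s \<le> star (f x) (g x)}"
        have A_eq: "D \<inter> {x \<in> space M. t \<le> \<phi> 1 (star (f x) (g x))} = A"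
          unfolding A_def s(2) using s(1) f g star by (subst level) auto
        have A: "A \<in> sets M" "A \<subseteq> D"
          unfolding A_def using assms(4) meas(3) by auto
        have "circ 1 t (\<mu> A) \<le> \<phi> 1 ?R"
        \<comment> \<open>Association concerns nonempty sets only, and the infimum over the empty
          set is \<infinity>, which need not lie in \<open>Y\<close>.\<close>
        proof (cases "A = {}")
          case True
          then show ?thesis
            using empty assms(11)[of 1 t] \<open>t \<in> Y\<close> by simp
        next
          case False
          then obtain x0 where x0: "x0 \<in> A" "x0 \<in> space M"
            using A D by blast
          define a b where "a = (INF x\<in>A. f x)" and "b = (INF x\<in>A. g x)"
          \<comment> \<open>Each infimum lies below the value at \<open>x0\<close>, and
            \<open>Y\<close> is closed downwards.\<close>
          have ab: "a \<in> Y" "b \<in> Y"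
            unfolding a_def b_def using x0 f g by (auto intro: down[OF INF_lower[OF x0(1)]])
          have "star a b = (INF x\<in>A. star (f x) (g x))"
            using assoc A False unfolding star_associated_def a_def b_def by simp
          also have "s \<le> \<dots>"
            unfolding A_def by (auto intro: INF_greatest)
          finally have "circ 1 t (\<mu> A) \<le> circ 1 (\<phi> 1 (star a b)) (\<mu> A)"
            using s ab star phi phi_le A by (intro mono_circ) auto
          also have "\<dots> \<le> \<phi> 1 ?R"
          proof -
            have "\<mu> A \<in> {\<mu> (A \<inter> D) | A. A \<in> sets M}"
              using A by (auto intro!: exI[of _ A] simp: Int_absorb2)
            then have "inv_into Y (\<phi> 1) (circ 1 (\<phi> 1 (star a b)) (\<mu> A))
              \<le> loz (inv_into Y (\<phi> 2) (circ 2 (\<phi> 2 a) (\<mu> A)))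
                    (inv_into Y (\<phi> 3) (circ 3 (\<phi> 3 b) (\<mu> A)))"
              using pt ab by blast
            also have "\<dots> \<le> ?R"
              using inf_ge[of 2 f A] inf_ge[of 3 g A] ab f g meas A I_Y circ phi
              unfolding a_def[symmetric] b_def[symmetric]
              by (intro mono_loz inv inv_mono) (auto simp: a_def b_def)
            finally show ?thesis
              using inv_le[of 1] circ phi star ab A R by auto
          qed
          finally show ?thesis .
        qed
        then show ?thesis
          by (simp only: A_eq)
      qed
      then have "?I 1 (\<lambda>x. star (f x) (g x)) \<le> \<phi> 1 ?R"
        unfolding upper_sugeno_def by (intro SUP_least)
      then show "inv_into Y (\<phi> 1) (?I 1 (\<lambda>x. star (f x) (g x))) \<le> ?R"
        using inv_le[of 1] I_Y R by blast
    qed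
  qed
qed

end
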